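(* Given two combinatorially equivalent triangulations (triangulated surfaces), the angle bisector preserving projective maps between corresponding triangles fit together continuously across edges if and only if the two triangulations are discretely conformally equivalent.
   Context: A triangulated surface here is a surface glued edge-to-edge from Euclidean triangles; $\ell_{ij}$ denotes the length of the edge joining vertices $i$ and $j$. For two combinatorially equivalent triangulated surfaces, $\ell_{ij}$ and $\tilde\ell_{ij}$ denote the lengths of corresponding edges. The two triangulated surfaces are called discretely conformally equivalent if they are combinatorially equivalent and there are real numbers $u_i$ (logarithmic scale factors) associated to the vertices such that $\tilde\ell_{ij}=e^{\frac12(u_i+u_j)}\ell_{ij}$ for all edges $ij$. It is known that this is equivalent to equality of length cross ratios: for every interior edge $ij$ with adjacent triangles $ijk$ and $ijm$, $$\frac{\ell_{im}\ell_{jk}}{\ell_{mj}\ell_{ki}}=\frac{\tilde\ell_{im}\tilde\ell_{jk}}{\tilde\ell_{mj}\tilde\ell_{ki}}.$$ For a pair of corresponding Euclidean triangles $T$, $\tilde T$, the angle bisector preserving projective map is the projective map that maps the vertices of $T$ to the corresponding vertices of $\tilde T$, maps $T$ onto $\tilde T$, and maps the three interior angle bisectors of $T$ to the corresponding interior angle bisectors of $\tilde T$ (equivalently, it maps incircle center to incircle center). The maps "fit together continuously across edges" if, for every interior edge, the maps on the two adjacent triangles agree on that edge. *)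

theory Defs
  imports "HOL-Analysis.Analysis"
begin

text \<open>A Euclidean triangle is given by its three labelled vertices \<open>p :: 3 \<Rightarrow> real^2\<close>.\<close>

definition triangle :: "(3 \<Rightarrow> real^2) \<Rightarrow> (real^2) set" where
  "triangle p = convex hull (range p)"

definition nondegenerate :: "(3 \<Rightarrow> real^2) \<Rightarrow> bool" where
  "nondegenerate p \<longleftrightarrow> inj p \<and> \<not> collinear (range p)"

text \<open>The unoriented angle in \<open>[0, pi]\<close>; it is \<open>pi / 2\<close> if one of the vectors is zero.\<close>

definition vec_angle :: "real^2 \<Rightarrow> real^2 \<Rightarrow> real" where
  "vec_angle v w = arccos ((v \<bullet> w) / (norm v * norm w))"

text \<open>The part inside the triangle of the interior angle bisector at the vertex \<open>p i\<close>.
  The vertex itself belongs to it, by the convention for the angle with the zero vector.\<close>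

definition angle_bisector :: "(3 \<Rightarrow> real^2) \<Rightarrow> 3 \<Rightarrow> (real^2) set" where
  "angle_bisector p i =
     {x \<in> triangle p. \<forall>j k. j \<noteq> i \<longrightarrow> k \<noteq> i \<longrightarrow>
        vec_angle (p j - p i) (x - p i) = vec_angle (p k - p i) (x - p i)}"

definition homogeneous :: "real^2 \<Rightarrow> real^3" where
  "homogeneous x = vector [x $ 1, x $ 2, 1]"

text \<open>\<open>f\<close> agrees on \<open>D\<close> with a projective transformation of the real projective plane
  that sends no point of \<open>D\<close> to the line at infinity.\<close>

definition projective_on :: "(real^2) set \<Rightarrow> (real^2 \<Rightarrow> real^2) \<Rightarrow> bool" where
  "projective_on D f \<longleftrightarrow>
     (\<exists>A :: real^3^3. invertible A \<and>
        (\<forall>x\<in>D. \<exists>w. w \<noteq> 0 \<and> A *v homogeneous x = w *\<^sub>R homogeneous (f x)))"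

definition bisector_preserving :: "(3 \<Rightarrow> real^2) \<Rightarrow> (3 \<Rightarrow> real^2) \<Rightarrow> (real^2 \<Rightarrow> real^2) \<Rightarrow> bool" where
  "bisector_preserving p q f \<longleftrightarrow>
     projective_on (triangle p) f \<and>
     (\<forall>i. f (p i) = q i) \<and>
     f ` triangle p = triangle q \<and>
     (\<forall>i. f ` angle_bisector p i = angle_bisector q i)"

text \<open>For nondegenerate triangles there is exactly one such map on \<open>triangle p\<close>;
  its extensionality makes it unique as a total function.\<close>

definition bisector_map :: "(3 \<Rightarrow> real^2) \<Rightarrow> (3 \<Rightarrow> real^2) \<Rightarrow> real^2 \<Rightarrow> real^2" where
  "bisector_map p q = (THE f. bisector_preserving p q f \<and> f \<in> extensional (triangle p))"

text \<open>A surface glued from triangles. An oriented side \<open>(t, i, j)\<close> with \<open>i \<noteq> j\<close> is the side of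
  the triangle \<open>t\<close> traversed from corner \<open>i\<close> to corner \<open>j\<close>. A pair
  \<open>((t, i, j), (s, k, l))\<close> in \<open>glue\<close> identifies these two sides isometrically, corner \<open>i\<close> of
  \<open>t\<close> with corner \<open>k\<close> of \<open>s\<close> and corner \<open>j\<close> of \<open>t\<close> with corner \<open>l\<close> of \<open>s\<close>. The edges need
  not be determined by their endpoints, a triangle may be glued to itself along two of its sides,
  and the surface may be non-orientable. Sides that are not glued form the boundary.\<close>

type_synonym 'f side = "'f \<times> 3 \<times> 3"

record 'f tri_complex =
  faces :: "'f set"
  glue :: "('f side \<times> 'f side) set"
  pos :: "'f \<Rightarrow> 3 \<Rightarrow> real^2"

definition sides :: "'f tri_complex \<Rightarrow> 'f side set" where
  "sides S = {(t, i, j). t \<in> faces S \<and> i \<noteq> j}"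

definition side_length :: "'f tri_complex \<Rightarrow> 'f side \<Rightarrow> real" where
  "side_length S = (\<lambda>(t, i, j). dist (pos S t i) (pos S t j))"

definition corners :: "'f tri_complex \<Rightarrow> ('f \<times> 3) set" where
  "corners S = faces S \<times> UNIV"

text \<open>The vertices of the surface are the classes of corners under the equivalence relation
  generated by the gluing. The step relation below is symmetric for a triangulated surface, so its
  reflexive transitive closure is that equivalence relation.\<close>

definition corner_rel :: "'f tri_complex \<Rightarrow> (('f \<times> 3) \<times> ('f \<times> 3)) set" where
  "corner_rel S = {((t, i), (s, k)) | t i s k. \<exists>j l. ((t, i, j), (s, k, l)) \<in> glue S}\<^sup>*"

definition vertex_of :: "'f tri_complex \<Rightarrow> 'f \<times> 3 \<Rightarrow> ('f \<times> 3) set" where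
  "vertex_of S c = corner_rel S `` {c}"

text \<open>Finiteness of the corner classes is local finiteness; without it the glued space would
  not be a surface near the vertex. The condition on \<open>(t, i, j)\<close> and \<open>{i, j} = {k, l}\<close> says that
  no side is glued to itself.\<close>

definition triangulated_surface :: "'f tri_complex \<Rightarrow> bool" where
  "triangulated_surface S \<longleftrightarrow>
     glue S \<subseteq> sides S \<times> sides S \<and> sym (glue S) \<and> single_valued (glue S) \<and>
     (\<forall>t i j s k l. ((t, i, j), (s, k, l)) \<in> glue S \<longrightarrow>
        ((t, j, i), (s, l, k)) \<in> glue S \<and>
        \<not> (t = s \<and> {i, j} = {k, l})) \<and>
     (\<forall>c\<in>corners S. finite (vertex_of S c)) \<and>
     (\<forall>t\<in>faces S. nondegenerate (pos S t)) \<and>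
     (\<forall>(e, e')\<in>glue S. side_length S e = side_length S e')"

text \<open>A combinatorial equivalence consists of a bijection \<open>\<phi>\<close> of the triangles and, for each
  triangle \<open>t\<close>, a bijection \<open>\<sigma> t\<close> of its corners onto those of \<open>\<phi> t\<close>, compatible with the
  gluings.\<close>

definition map_side :: "('f \<Rightarrow> 'g) \<Rightarrow> ('f \<Rightarrow> 3 \<Rightarrow> 3) \<Rightarrow> 'f side \<Rightarrow> 'g side" where
  "map_side \<phi> \<sigma> = (\<lambda>(t, i, j). (\<phi> t, \<sigma> t i, \<sigma> t j))"

definition combinatorial_equivalence ::
    "'f tri_complex \<Rightarrow> 'g tri_complex \<Rightarrow> ('f \<Rightarrow> 'g) \<Rightarrow> ('f \<Rightarrow> 3 \<Rightarrow> 3) \<Rightarrow> bool" where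
  "combinatorial_equivalence S S' \<phi> \<sigma> \<longleftrightarrow>
     bij_betw \<phi> (faces S) (faces S') \<and> (\<forall>t\<in>faces S. bij (\<sigma> t)) \<and>
     (\<forall>e\<in>sides S. \<forall>e'\<in>sides S.
        (e, e') \<in> glue S \<longleftrightarrow> (map_side \<phi> \<sigma> e, map_side \<phi> \<sigma> e') \<in> glue S')"

text \<open>Scale factors \<open>u\<close> are assigned to the vertices of \<open>S\<close>, hence also to the corresponding
  vertices of \<open>S'\<close>.\<close>

definition discretely_conformally_equivalent ::
    "'f tri_complex \<Rightarrow> 'g tri_complex \<Rightarrow> ('f \<Rightarrow> 'g) \<Rightarrow> ('f \<Rightarrow> 3 \<Rightarrow> 3) \<Rightarrow> bool" where
  "discretely_conformally_equivalent S S' \<phi> \<sigma> \<longleftrightarrow>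
     combinatorial_equivalence S S' \<phi> \<sigma> \<and>
     (\<exists>u :: ('f \<times> 3) set \<Rightarrow> real. \<forall>(t, i, j)\<in>sides S.
        side_length S' (map_side \<phi> \<sigma> (t, i, j)) =
          exp ((u (vertex_of S (t, i)) + u (vertex_of S (t, j))) / 2) * side_length S (t, i, j))"

text \<open>\<open>x\<close> on the first side and \<open>y\<close> on the second are the same point if these sides are glued.\<close>

definition same_edge_point :: "'f tri_complex \<Rightarrow> 'f side \<Rightarrow> 'f side \<Rightarrow> real^2 \<Rightarrow> real^2 \<Rightarrow> bool" where
  "same_edge_point S = (\<lambda>(t, i, j) (s, k, l) x y. \<exists>r\<in>{0..1}.
     x = (1 - r) *\<^sub>R pos S t i + r *\<^sub>R pos S t j \<and>
     y = (1 - r) *\<^sub>R pos S s k + r *\<^sub>R pos S s l)"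

definition fit_together ::
    "'f tri_complex \<Rightarrow> 'g tri_complex \<Rightarrow> ('f \<Rightarrow> 'g) \<Rightarrow> ('f \<Rightarrow> 3 \<Rightarrow> 3) \<Rightarrow>
     ('f \<Rightarrow> real^2 \<Rightarrow> real^2) \<Rightarrow> bool" where
  "fit_together S S' \<phi> \<sigma> F \<longleftrightarrow>
     (\<forall>(e, e')\<in>glue S. \<forall>x y. same_edge_point S e e' x y \<longrightarrow>
        same_edge_point S' (map_side \<phi> \<sigma> e) (map_side \<phi> \<sigma> e') (F (fst e) x) (F (fst e') y))"

end

theory Submission
  imports Defs
begin

text \<open>In barycentric coordinates a projective map that sends the vertices of a triangle \<open>p\<close> to
  those of \<open>q\<close> is diagonal: it multiplies the coordinates by nonzero weights and renormalises
  their sum. The incentre has barycentric coordinates proportional to the lengths of the opposite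
  sides, so the bisectors are preserved exactly when the weight at a vertex is, up to a common
  factor, the ratio \<open>\<mu>\<close> by which the opposite side is stretched. This determines the
  bisector preserving map (\<open>bisector_map_bary_point\<close>).

  On the edge \<open>ij\<close> such a map depends only on the quotient of \<open>\<mu> i\<close> and \<open>\<mu> j\<close>, so the maps
  on two glued triangles agree along the common edge if and only if these quotients coincide
  (\<open>bisector_maps_agree_on_edge_iff\<close>).

  Inside a single triangle, three side ratios are always of the form
  \<open>exp ((u i + u j) / 2)\<close> for exactly one choice of \<open>u\<close> at the corners, namely
  \<open>u i = (\<Sum>k. ln (\<mu> k)) - 2 * ln (\<mu> i)\<close>. Hence discrete conformal equivalence means that these
  corner values are constant on each vertex class. Along a glued edge the sum \<open>u i + u j\<close> is the
  same on both sides because the edge lengths are, while the difference \<open>u i - u j\<close> is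
  \<open>-2 * ln (\<mu> i / \<mu> j)\<close>. So equality of the quotients of weights is the same as equality of
  the two corner values at each end of the edge (\<open>bisector_weight_ratio_iff\<close>).\<close>

section \<open>Barycentric coordinates\<close>

definition bary_coords :: "(3 \<Rightarrow> real) set" where
  "bary_coords = {b. (\<forall>k. 0 \<le> b k) \<and> sum b UNIV = 1}"

definition bary_point :: "(3 \<Rightarrow> real^2) \<Rightarrow> (3 \<Rightarrow> real) \<Rightarrow> real^2" where
  "bary_point p b = (\<Sum>k\<in>UNIV. b k *\<^sub>R p k)"

lemma other_corner:
  fixes i :: 3
  obtains j where "j \<noteq> i"
  using that[of 1] that[of 2] by (cases "i = 1") auto

lemma third_corner:
  fixes i j :: 3
  assumes "i \<noteq> j"
  obtains m where "m \<noteq> i" "m \<noteq> j" "UNIV = {i, j, m}"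
proof -
  have "card {i, j} < card (UNIV :: 3 set)" using assms by simp
  then have "{i, j} \<noteq> UNIV" by (metis less_irrefl)
  then obtain m where m: "m \<noteq> i" "m \<noteq> j" by blast
  with assms have "card {i, j, m} = card (UNIV :: 3 set)" by simp
  then have "{i, j, m} = UNIV" by (intro card_subset_eq) auto
  with m show thesis using that by blast
qed

lemma distinct_corners_UNIV:
  fixes i j k :: 3
  assumes "i \<noteq> j" "i \<noteq> k" "j \<noteq> k"
  shows "UNIV = {i, j, k}"
proof -
  obtain m where "m \<noteq> i" "m \<noteq> j" "UNIV = {i, j, m}" using third_corner[OF assms(1)] .
  then show ?thesis using assms by (metis UNIV_I insertE singletonD)
qed

lemma sum_distinct_corners:
  fixes i j k :: 3 and g :: "3 \<Rightarrow> 'a::comm_monoid_add"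
  assumes "i \<noteq> j" "i \<noteq> k" "j \<noteq> k"
  shows "sum g UNIV = g i + (g j + g k)"
  using assms by (simp add: distinct_corners_UNIV[OF assms])

lemma triangle_eq_bary: "triangle p = bary_point p ` bary_coords"
proof -
  have "triangle p = convex hull {p 1, p 2, p 3}"
    by (simp add: triangle_def UNIV_3)
  also have "\<dots> = bary_point p ` bary_coords"
  proof (intro subset_antisym subsetI)
    fix x assume "x \<in> convex hull {p 1, p 2, p 3}"
    then obtain u v w where uvw: "0 \<le> u" "0 \<le> v" "0 \<le> w" "u + v + w = 1"
      "x = u *\<^sub>R p 1 + v *\<^sub>R p 2 + w *\<^sub>R p 3"
      by (auto simp: convex_hull_3)
    let ?b = "\<lambda>k::3. if k = 1 then u else if k = 2 then v else w"
    have "?b \<in> bary_coords" "x = bary_point p ?b"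
      using uvw by (auto simp: bary_coords_def bary_point_def sum_3)
    then show "x \<in> bary_point p ` bary_coords" by blast
  next
    fix x assume "x \<in> bary_point p ` bary_coords"
    then obtain b where b: "\<And>k. 0 \<le> b k" "sum b UNIV = 1" "x = bary_point p b"
      by (auto simp: bary_coords_def)
    then show "x \<in> convex hull {p 1, p 2, p 3}"
      unfolding convex_hull_3 bary_point_def sum_3
      by (intro CollectI exI[of _ "b 1"] exI[of _ "b 2"] exI[of _ "b 3"]) simp
  qed
  finally show ?thesis .
qed

lemma bary_independent:
  assumes p: "nondegenerate p" and s: "sum c UNIV = 0" and z: "bary_point p c = 0"
  shows "c k = 0"
proof (rule ccontr)
  assume nz: "c k \<noteq> 0"
  have inj: "inj p" using p by (simp add: nondegenerate_def)
  let ?U = "\<lambda>v. c (inv p v)"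
  have "sum ?U (range p) = 0"
    using s by (simp add: sum.reindex[OF inj] inv_f_f[OF inj])
  moreover have "(\<Sum>v\<in>range p. ?U v *\<^sub>R v) = 0"
    using z by (simp add: sum.reindex[OF inj] inv_f_f[OF inj] bary_point_def)
  moreover have "\<exists>v\<in>range p. ?U v \<noteq> 0"
    using nz by (auto simp: inv_f_f[OF inj])
  ultimately have "affine_dependent (range p)"
    unfolding affine_dependent_explicit_finite[OF finite_imageI[OF finite_class.finite_UNIV, of p]]
    by (intro exI[of _ ?U] conjI)
  then have "collinear (range p)"
    by (simp add: UNIV_3 collinear_3_eq_affine_dependent)
  then show False using p by (simp add: nondegenerate_def)
qed

lemma bary_point_inject:
  assumes "nondegenerate p" "sum b UNIV = sum c UNIV" "bary_point p b = bary_point p c"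
  shows "b = c"
proof
  fix k
  have "sum (\<lambda>k. b k - c k) UNIV = 0" using assms(2) by (simp add: sum_subtractf)
  moreover have "bary_point p (\<lambda>k. b k - c k) = 0"
    using assms(3) by (simp add: bary_point_def sum_subtractf scaleR_left_diff_distrib)
  ultimately show "b k = c k" using bary_independent[OF assms(1)] by fastforce
qed

lemma inj_on_bary_point:
  assumes "nondegenerate p"
  shows "inj_on (bary_point p) bary_coords"
  using bary_point_inject[OF assms] by (auto simp: inj_on_def bary_coords_def)

section \<open>Projective maps between triangles\<close>

text \<open>The action on barycentric coordinates of the projective map with \<open>p k \<mapsto> q k\<close> whose matrix
  is diagonal with entries \<open>w\<close> in the frames of homogeneous vertex coordinates.\<close>

definition reweight :: "(3 \<Rightarrow> real) \<Rightarrow> (3 \<Rightarrow> real) \<Rightarrow> 3 \<Rightarrow> real" where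
  "reweight w b k = b k * w k / (\<Sum>l\<in>UNIV. b l * w l)"

lemma weighted_sum_pos:
  assumes "b \<in> bary_coords" "\<And>k. 0 < w k"
  shows "0 < (\<Sum>k\<in>UNIV. b k * w k)"
proof -
  have "\<exists>k. b k \<noteq> 0"
  proof (rule ccontr)
    assume "\<not> ?thesis" then show False using assms(1) by (simp add: bary_coords_def)
  qed
  then obtain k where "b k \<noteq> 0" by blast
  then have "0 < b k" using assms(1) by (simp add: bary_coords_def order_less_le)
  then show ?thesis
    using assms by (intro sum_pos2[of _ k]) (auto simp: bary_coords_def order_less_imp_le)
qed

lemma reweight_bary:
  assumes "b \<in> bary_coords" "\<And>k. 0 < w k"
  shows "reweight w b \<in> bary_coords"
  using weighted_sum_pos[where w = w, OF assms] assms
  by (auto simp: bary_coords_def reweight_def sum_divide_distrib[symmetric]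
      order_less_imp_le intro!: divide_nonneg_pos)

lemma reweight_reweight:
  assumes "b \<in> bary_coords" "\<And>k. 0 < w k" "\<And>k. v k = 1 / w k"
  shows "reweight v (reweight w b) = b"
proof
  fix k
  let ?W = "\<Sum>l\<in>UNIV. b l * w l"
  have W: "0 < ?W" using weighted_sum_pos[where w = w, OF assms(1,2)] .
  have r: "reweight w b l * v l = b l / ?W" for l
    using assms(2)[of l] by (simp add: reweight_def assms(3))
  have "(\<Sum>l\<in>UNIV. reweight w b l * v l) = 1 / ?W"
    using assms(1) by (simp add: r sum_divide_distrib[symmetric] bary_coords_def)
  then show "reweight v (reweight w b) k = b k"
    unfolding reweight_def[of v] r using W by simp
qed

lemma reweight_scale:
  assumes "K \<noteq> 0" "\<And>k. w k = K * v k"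
  shows "reweight w b = reweight v b"
proof
  fix k
  have "(\<Sum>l\<in>UNIV. b l * w l) = K * (\<Sum>l\<in>UNIV. b l * v l)"
    by (simp add: assms(2) sum_distrib_left mult_ac)
  then show "reweight w b k = reweight v b k"
    using assms(1) by (simp add: reweight_def assms(2))
qed

lemma homogeneous_component:
  "homogeneous x $ 1 = x $ 1" "homogeneous x $ 2 = x $ 2" "homogeneous x $ 3 = 1"
  by (simp_all add: homogeneous_def vector_3)

text \<open>Homogeneous vertex coordinates can be combined with coefficients of any nonzero sum: the third
  component records that sum, and dividing by it gives a point of the plane.\<close>

lemma sum_homogeneous:
  assumes "sum c UNIV \<noteq> 0"
  shows "(\<Sum>k\<in>UNIV. c k *\<^sub>R homogeneous (p k)) =
    sum c UNIV *\<^sub>R homogeneous (bary_point p (\<lambda>k. c k / sum c UNIV))"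
proof -
  have "sum c UNIV * (c k / sum c UNIV) = c k" for k using assms by simp
  then show ?thesis
    unfolding vec_eq_iff forall_3
    by (simp add: homogeneous_component bary_point_def sum_distrib_left
        mult.assoc[symmetric] del: times_divide_eq_right times_divide_eq_left)
qed

lemma sum_homogeneous_bary:
  assumes "sum b UNIV = 1"
  shows "homogeneous (bary_point p b) = (\<Sum>k\<in>UNIV. b k *\<^sub>R homogeneous (p k))"
  using sum_homogeneous[of b p] assms by simp

lemma homogeneous_eq_scaled:
  assumes "v *\<^sub>R homogeneous x = w *\<^sub>R homogeneous y" "w \<noteq> 0"
  shows "x = y"
proof -
  have "v = w" using arg_cong[OF assms(1), of "\<lambda>z. z $ 3"] by (simp add: homogeneous_component)
  with assms have "homogeneous x = homogeneous y" by simp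
  then show ?thesis
    unfolding vec_eq_iff forall_2 forall_3 by (simp add: homogeneous_component)
qed

text \<open>The columns are the homogeneous coordinates of the vertices, scaled by \<open>w\<close>. The quotient of two
  such matrices is the matrix of a projective map between the triangles.\<close>

definition weighted_frame :: "(3 \<Rightarrow> real) \<Rightarrow> (3 \<Rightarrow> real^2) \<Rightarrow> real^3^3" where
  "weighted_frame w p = (\<chi> r k. w k * homogeneous (p k) $ r)"

lemma weighted_frame_mult:
  "weighted_frame w p *v (\<chi> k. b k) = (\<Sum>k\<in>UNIV. (b k * w k) *\<^sub>R homogeneous (p k))"
  by (simp add: weighted_frame_def matrix_vector_mult_def vec_eq_iff mult_ac)

lemma invertible_weighted_frame:
  assumes p: "nondegenerate p" and w: "\<And>k. w k \<noteq> 0"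
  shows "invertible (weighted_frame w p)"
  unfolding invertible_left_inverse matrix_left_invertible_ker
proof (intro allI impI)
  fix x :: "real^3" assume z: "weighted_frame w p *v x = 0"
  have "weighted_frame w p *v x = (\<Sum>k\<in>UNIV. (x $ k * w k) *\<^sub>R homogeneous (p k))"
    using weighted_frame_mult[of w p "\<lambda>k. x $ k"] by simp
  with z have s: "(\<Sum>k\<in>UNIV. (x $ k * w k) *\<^sub>R homogeneous (p k)) = 0" by simp
  have "(\<Sum>k\<in>UNIV. x $ k * w k) = 0"
    using arg_cong[OF s, of "\<lambda>z. z $ 3"] by (simp add: homogeneous_component)
  moreover have "bary_point p (\<lambda>k. x $ k * w k) = 0"
    using arg_cong[OF s, of "\<lambda>z. z $ 1"] arg_cong[OF s, of "\<lambda>z. z $ 2"]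
    by (simp add: homogeneous_component bary_point_def vec_eq_iff forall_2)
  ultimately have "x $ k * w k = 0" for k
    using bary_independent[OF p, of "\<lambda>k. x $ k * w k" k] by simp
  then show "x = 0" using w by (simp add: vec_eq_iff)
qed

lemma projective_on_reweight:
  assumes p: "nondegenerate p" and q: "nondegenerate q" and w: "\<And>k. 0 < w k"
    and f: "\<And>b. b \<in> bary_coords \<Longrightarrow> f (bary_point p b) = bary_point q (reweight w b)"
  shows "projective_on (triangle p) f"
proof -
  define P where "P = weighted_frame (\<lambda>_. 1) p"
  have "invertible P" unfolding P_def by (rule invertible_weighted_frame[OF p]) simp
  then obtain B where B: "P ** B = mat 1" "B ** P = mat 1" unfolding invertible_def by blast
  define A where "A = weighted_frame w q ** B"
  have "w k \<noteq> 0" for k using w[of k] by simp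
  then have "invertible (weighted_frame w q)" by (rule invertible_weighted_frame[OF q])
  moreover have "invertible B" using B unfolding invertible_def by blast
  ultimately have "invertible A" unfolding A_def by (rule invertible_mult)
  moreover have "\<exists>v. v \<noteq> 0 \<and> A *v homogeneous x = v *\<^sub>R homogeneous (f x)"
    if x: "x \<in> triangle p" for x
  proof -
    obtain b where b: "b \<in> bary_coords" "x = bary_point p b"
      using x by (auto simp: triangle_eq_bary)
    have "homogeneous x = P *v (\<chi> k. b k)"
      using b by (simp add: P_def weighted_frame_mult sum_homogeneous_bary bary_coords_def)
    then have "A *v homogeneous x = weighted_frame w q *v ((B ** P) *v (\<chi> k. b k))"
      by (simp add: A_def matrix_vector_mul_assoc matrix_mul_assoc)
    then have "A *v homogeneous x = (\<Sum>k\<in>UNIV. (b k * w k) *\<^sub>R homogeneous (q k))"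
      by (simp add: B weighted_frame_mult)
    moreover have W: "(\<Sum>k\<in>UNIV. b k * w k) \<noteq> 0" using weighted_sum_pos[where w = w, OF b(1) w] by simp
    moreover have "f x = bary_point q (\<lambda>k. b k * w k / (\<Sum>k\<in>UNIV. b k * w k))"
      using f[OF b(1)] b(2) by (simp add: reweight_def[abs_def])
    ultimately show ?thesis using sum_homogeneous[OF W, of q] by auto
  qed
  ultimately show ?thesis unfolding projective_on_def by blast
qed

text \<open>The matrix of \<open>f\<close> multiplies the homogeneous coordinates of the vertices by some factors \<open>w\<close>;
  by linearity these factors describe \<open>f\<close> on the whole triangle. The sum in the conclusion is
  the homogeneous scaling factor at the point, so it cannot vanish although the signs of \<open>w\<close> are
  arbitrary.\<close>

lemma projective_on_imp_reweight:
  assumes f: "projective_on (triangle p) f" and v: "\<And>i. f (p i) = q i"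
  obtains w where "\<And>k. w k \<noteq> 0"
    and "\<And>b. b \<in> bary_coords \<Longrightarrow>
      (\<Sum>k\<in>UNIV. b k * w k) \<noteq> 0 \<and> f (bary_point p b) = bary_point q (reweight w b)"
proof -
  obtain A :: "real^3^3" where
    A: "\<And>x. x \<in> triangle p \<Longrightarrow> \<exists>w. w \<noteq> 0 \<and> A *v homogeneous x = w *\<^sub>R homogeneous (f x)"
    using f unfolding projective_on_def by blast
  have "p i \<in> triangle p" for i by (simp add: triangle_def hull_inc)
  then have "\<exists>w. w \<noteq> 0 \<and> A *v homogeneous (p i) = w *\<^sub>R homogeneous (q i)" for i
    using A[of "p i"] v by simp
  then obtain w where w: "\<And>i. w i \<noteq> 0" "\<And>i. A *v homogeneous (p i) = w i *\<^sub>R homogeneous (q i)"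
    by metis
  have "(\<Sum>k\<in>UNIV. b k * w k) \<noteq> 0 \<and> f (bary_point p b) = bary_point q (reweight w b)"
    if b: "b \<in> bary_coords" for b
  proof -
    let ?W = "\<Sum>k\<in>UNIV. b k * w k"
    have "bary_point p b \<in> triangle p" using b by (simp add: triangle_eq_bary)
    then obtain y where y: "y \<noteq> 0"
      "A *v homogeneous (bary_point p b) = y *\<^sub>R homogeneous (f (bary_point p b))"
      using A by blast
    have "A *v homogeneous (bary_point p b) = (\<Sum>k\<in>UNIV. b k *\<^sub>R (A *v homogeneous (p k)))"
      using b by (simp add: sum_homogeneous_bary bary_coords_def matrix_vector_mult_scaleR
          linear_sum[OF matrix_vector_mul_linear])
    then have e: "(\<Sum>k\<in>UNIV. (b k * w k) *\<^sub>R homogeneous (q k)) =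
        y *\<^sub>R homogeneous (f (bary_point p b))"
      using y w by simp
    have "(\<Sum>k\<in>UNIV. (b k * w k) *\<^sub>R homogeneous (q k)) $ 3 =
        (y *\<^sub>R homogeneous (f (bary_point p b))) $ 3"
      using e by simp
    then have "?W = y" by (simp add: homogeneous_component)
    with y have W: "?W \<noteq> 0" by simp
    have "y *\<^sub>R homogeneous (f (bary_point p b)) =
        ?W *\<^sub>R homogeneous (bary_point q (\<lambda>k. b k * w k / ?W))"
      unfolding e[symmetric] by (rule sum_homogeneous[OF W])
    then have "f (bary_point p b) = bary_point q (\<lambda>k. b k * w k / ?W)"
      using W by (rule homogeneous_eq_scaled)
    with W show ?thesis by (simp add: reweight_def[abs_def])
  qed
  with w(1) show thesis using that by blast
qed

section \<open>Angle bisectors\<close>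

definition opp_side :: "(3 \<Rightarrow> real^2) \<Rightarrow> 3 \<Rightarrow> real" where
  "opp_side p i = (if i = 1 then dist (p 2) (p 3) else if i = 2 then dist (p 3) (p 1)
     else dist (p 1) (p 2))"

lemma opp_side_eq:
  assumes "i \<noteq> j" "i \<noteq> k" "j \<noteq> k"
  shows "opp_side p k = dist (p i) (p j)"
  using exhaust_3[of i] exhaust_3[of j] exhaust_3[of k] assms
  by (elim disjE) (simp_all add: opp_side_def dist_commute)

lemma opp_side_pos:
  assumes "nondegenerate p"
  shows "0 < opp_side p k"
proof -
  have "inj p" using assms by (simp add: nondegenerate_def)
  then show ?thesis by (simp add: opp_side_def inj_eq)
qed

text \<open>With the unit vectors \<open>e\<close>, \<open>e'\<close> along \<open>v\<close>, \<open>v'\<close>, equality of the angles says that \<open>w\<close> is orthogonal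
  to \<open>e - e'\<close>. For \<open>w = \<beta> e + \<gamma> e'\<close> the inner product of the two is
  \<open>(\<beta> - \<gamma>) (1 - e \<bullet> e')\<close>, and the second factor is nonzero unless the vectors point in the
  same direction. The argument covers \<open>w = 0\<close>, where both angles are \<open>pi / 2\<close>.\<close>

lemma vec_angle_eq_iff:
  assumes v: "v \<noteq> 0" "v' \<noteq> 0" and ne: "v \<bullet> v' \<noteq> norm v * norm v'"
    and w: "w = b *\<^sub>R v + c *\<^sub>R v'"
  shows "vec_angle v w = vec_angle v' w \<longleftrightarrow> b * norm v = c * norm v'"
proof -
  have bound: "\<bar>(u \<bullet> w) / (norm u * norm w)\<bar> \<le> 1" for u
    using Cauchy_Schwarz_ineq2[of u w]
    by (cases "u = 0 \<or> w = 0") (auto simp: abs_mult divide_le_eq_1 zero_less_mult_iff)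
  have n: "norm v > 0" "norm v' > 0" using v by simp_all
  have "vec_angle v w = vec_angle v' w \<longleftrightarrow>
      (v \<bullet> w) / (norm v * norm w) = (v' \<bullet> w) / (norm v' * norm w)"
    unfolding vec_angle_def using bound by (intro arccos_eq_iff) blast
  also have "\<dots> \<longleftrightarrow> (v \<bullet> w) * norm v' = (v' \<bullet> w) * norm v"
    using n by (cases "w = 0") (auto simp: field_simps)
  also have "\<dots> \<longleftrightarrow> (b * norm v - c * norm v') * (norm v * norm v' - v \<bullet> v') = 0"
  proof -
    have "(v \<bullet> w) * norm v' - (v' \<bullet> w) * norm v =
        (b * norm v - c * norm v') * (norm v * norm v' - v \<bullet> v')"
      unfolding w
      by (simp add: inner_add_right inner_commute[of v' v] power2_norm_eq_inner[symmetric]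
          power2_eq_square algebra_simps)
    then show ?thesis by auto
  qed
  also have "\<dots> \<longleftrightarrow> b * norm v = c * norm v'" using ne by auto
  finally show ?thesis .
qed

lemma nondegenerate_not_parallel:
  assumes p: "nondegenerate p" and d: "i \<noteq> j" "i \<noteq> k" "j \<noteq> k"
  shows "(p j - p i) \<bullet> (p k - p i) \<noteq> norm (p j - p i) * norm (p k - p i)"
proof
  assume "(p j - p i) \<bullet> (p k - p i) = norm (p j - p i) * norm (p k - p i)"
  then have e: "norm (p j - p i) *\<^sub>R (p k - p i) = norm (p k - p i) *\<^sub>R (p j - p i)"
    by (simp add: norm_cauchy_schwarz_eq)
  let ?c = "\<lambda>m. if m = k then norm (p j - p i) else if m = j then - norm (p k - p i)
     else norm (p k - p i) - norm (p j - p i)"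
  have "sum ?c UNIV = 0" using d by (simp add: sum_distinct_corners[OF d])
  moreover have "bary_point p ?c = 0"
    using d e by (simp add: bary_point_def sum_distinct_corners[OF d] algebra_simps)
  ultimately have "?c k = 0" by (rule bary_independent[OF p])
  then have "p j = p i" by simp
  then show False using p d by (auto simp: nondegenerate_def inj_def)
qed

lemma bary_point_minus_vertex:
  assumes b: "sum b UNIV = 1" and d: "i \<noteq> j" "i \<noteq> k" "j \<noteq> k"
  shows "bary_point p b - p i = b j *\<^sub>R (p j - p i) + b k *\<^sub>R (p k - p i)"
proof -
  have bi: "b i = 1 - b j - b k" using b by (simp add: sum_distinct_corners[OF d])
  show ?thesis
    unfolding bary_point_def sum_distinct_corners[OF d] bi by (simp add: algebra_simps)
qed

text \<open>The bisector from \<open>p i\<close> thus consists of the points whose other two coordinates have the ratio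
  of the opposite sides, which shows that \<open>opp_side p\<close> itself gives the incentre.\<close>

lemma bary_point_in_angle_bisector_iff:
  assumes p: "nondegenerate p" and b: "b \<in> bary_coords"
  shows "bary_point p b \<in> angle_bisector p i \<longleftrightarrow>
    (\<forall>j k. j \<noteq> i \<longrightarrow> k \<noteq> i \<longrightarrow> b j * opp_side p k = b k * opp_side p j)"
proof -
  have "vec_angle (p j - p i) (bary_point p b - p i) = vec_angle (p k - p i) (bary_point p b - p i)
      \<longleftrightarrow> b j * opp_side p k = b k * opp_side p j" if "j \<noteq> i" "k \<noteq> i" for j k
  proof (cases "j = k")
    case False
    with that have d: "i \<noteq> j" "i \<noteq> k" "j \<noteq> k" "j \<noteq> i" "k \<noteq> i" "k \<noteq> j" by auto
    have "p j - p i \<noteq> 0" "p k - p i \<noteq> 0"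
      using p d by (auto simp: nondegenerate_def inj_def)
    moreover have "opp_side p k = norm (p j - p i)" "opp_side p j = norm (p k - p i)"
      using opp_side_eq[of j i k p] opp_side_eq[of k i j p] d by (simp_all add: dist_norm)
    moreover have "sum b UNIV = 1" using b by (simp add: bary_coords_def)
    ultimately show ?thesis
      using vec_angle_eq_iff nondegenerate_not_parallel[OF p d(1-3)] bary_point_minus_vertex d(1-3)
      by metis
  qed simp
  moreover have "bary_point p b \<in> triangle p" using b by (simp add: triangle_eq_bary)
  ultimately show ?thesis by (auto simp: angle_bisector_def)
qed

section \<open>The bisector preserving map\<close>

definition bisector_weight :: "(3 \<Rightarrow> real^2) \<Rightarrow> (3 \<Rightarrow> real^2) \<Rightarrow> 3 \<Rightarrow> real" where
  "bisector_weight p q k = opp_side q k / opp_side p k"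

lemma bisector_weight_pos:
  "nondegenerate p \<Longrightarrow> nondegenerate q \<Longrightarrow> 0 < bisector_weight p q k"
  by (simp add: bisector_weight_def opp_side_pos)

lemma bisector_weight_swap: "bisector_weight q p k = 1 / bisector_weight p q k"
  by (simp add: bisector_weight_def)

text \<open>The weights turn the ratio of side lengths that describes a bisector of \<open>p\<close> into the one that
  describes the corresponding bisector of \<open>q\<close>.\<close>

lemma reweight_in_angle_bisector_iff:
  assumes p: "nondegenerate p" and q: "nondegenerate q" and b: "b \<in> bary_coords"
  shows "bary_point q (reweight (bisector_weight p q) b) \<in> angle_bisector q i \<longleftrightarrow>
    bary_point p b \<in> angle_bisector p i"
proof -
  let ?m = "bisector_weight p q"
  have W: "0 < (\<Sum>l\<in>UNIV. b l * ?m l)"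
    by (intro weighted_sum_pos b bisector_weight_pos p q)
  have "reweight ?m b j * opp_side q k = reweight ?m b k * opp_side q j \<longleftrightarrow>
      b j * opp_side p k = b k * opp_side p j" for j k
  proof -
    have pos: "0 < opp_side p j" "0 < opp_side p k" "0 < opp_side q j" "0 < opp_side q k"
      using opp_side_pos p q by blast+
    have "reweight ?m b j * opp_side q k = reweight ?m b k * opp_side q j \<longleftrightarrow>
       b j * ?m j * opp_side q k = b k * ?m k * opp_side q j"
      using W by (simp add: reweight_def field_simps)
    also have "\<dots> \<longleftrightarrow> b j * opp_side p k = b k * opp_side p j"
      using pos by (simp add: bisector_weight_def field_simps)
    finally show ?thesis .
  qed
  moreover have "reweight ?m b \<in> bary_coords"
    by (intro reweight_bary b bisector_weight_pos p q)
  ultimately show ?thesis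
    using bary_point_in_angle_bisector_iff[OF p b] bary_point_in_angle_bisector_iff[OF q] by simp
qed

text \<open>Existence of the bisector preserving map. Surjectivity holds because exchanging the two triangles
  inverts the weights.\<close>

lemma bisector_preserving_reweight:
  assumes p: "nondegenerate p" and q: "nondegenerate q"
    and f: "\<And>b. b \<in> bary_coords \<Longrightarrow>
      f (bary_point p b) = bary_point q (reweight (bisector_weight p q) b)"
  shows "bisector_preserving p q f"
proof -
  let ?m = "bisector_weight p q"
  have m: "\<And>k. 0 < ?m k" using bisector_weight_pos[OF p q] .
  have onto: "\<exists>b\<in>bary_coords. reweight ?m b = c" if c: "c \<in> bary_coords" for c
    using reweight_reweight[where w = "bisector_weight q p" and v = ?m,
        OF c bisector_weight_pos[OF q p] bisector_weight_swap]
      reweight_bary[where w = "bisector_weight q p", OF c bisector_weight_pos[OF q p]]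
    by blast
  have "projective_on (triangle p) f" using projective_on_reweight[where w = ?m, OF p q m f] .
  moreover have "f (p i) = q i" for i
  proof -
    let ?e = "\<lambda>k. if k = i then 1 else 0::real"
    have e: "?e \<in> bary_coords" by (auto simp: bary_coords_def)
    have pt: "bary_point r ?e = r i" for r
      by (simp add: bary_point_def if_distrib[of "\<lambda>x. x *\<^sub>R _"] cong: if_cong)
    have "reweight ?m ?e = ?e"
      using m[of i] by (auto simp: reweight_def fun_eq_iff if_distrib[of "\<lambda>x. x * _"] cong: if_cong)
    then show ?thesis using f[OF e] pt by simp
  qed
  moreover have "f ` triangle p = triangle q"
    using onto reweight_bary[where w = ?m, OF _ m]
    by (force simp: triangle_eq_bary image_iff f)
  moreover have "f ` angle_bisector p i = angle_bisector q i" for i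
  proof (intro subset_antisym subsetI)
    fix y assume "y \<in> f ` angle_bisector p i"
    then obtain x where x: "x \<in> angle_bisector p i" "y = f x" by blast
    then obtain b where "b \<in> bary_coords" "x = bary_point p b"
      by (auto simp: angle_bisector_def triangle_eq_bary)
    then show "y \<in> angle_bisector q i"
      using x f reweight_in_angle_bisector_iff[OF p q] by simp
  next
    fix y assume y: "y \<in> angle_bisector q i"
    then obtain c where "c \<in> bary_coords" "y = bary_point q c"
      by (auto simp: angle_bisector_def triangle_eq_bary)
    with onto obtain b where b: "b \<in> bary_coords" "y = bary_point q (reweight ?m b)" by blast
    then have "bary_point p b \<in> angle_bisector p i"
      using y reweight_in_angle_bisector_iff[OF p q] by simp
    then show "y \<in> f ` angle_bisector p i" using b f by force
  qed
  ultimately show ?thesis by (simp add: bisector_preserving_def)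
qed

text \<open>Uniqueness. The incentre lies on all three bisectors, so its image lies on all three bisectors of
  \<open>q\<close> and is the incentre of \<open>q\<close>. Comparing coordinates fixes the weights up to a common
  factor.\<close>

lemma bisector_preserving_imp_reweight:
  assumes p: "nondegenerate p" and q: "nondegenerate q"
    and f: "bisector_preserving p q f" and b: "b \<in> bary_coords"
  shows "f (bary_point p b) = bary_point q (reweight (bisector_weight p q) b)"
proof -
  obtain w where w: "\<And>k. w k \<noteq> 0"
    and fw: "\<And>b. b \<in> bary_coords \<Longrightarrow>
      (\<Sum>k\<in>UNIV. b k * w k) \<noteq> 0 \<and> f (bary_point p b) = bary_point q (reweight w b)"
    using projective_on_imp_reweight[of p f q] f unfolding bisector_preserving_def by metis
  \<comment> \<open>barycentric coordinates of the incentre\<close>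
  define inc where "inc k = opp_side p k / sum (opp_side p) UNIV" for k
  have pos: "0 < opp_side p k" "0 < opp_side q k" for k using opp_side_pos p q by blast+
  then have sp: "0 < sum (opp_side p) UNIV" by (intro sum_pos) auto
  have inc: "inc \<in> bary_coords"
    using pos sp by (auto simp: bary_coords_def inc_def sum_divide_distrib[symmetric]
        order_less_imp_le)
  have "bary_point p inc \<in> angle_bisector p i" for i
    by (simp add: bary_point_in_angle_bisector_iff[OF p inc] inc_def)
  then have image: "f (bary_point p inc) \<in> angle_bisector q i" for i
    using f unfolding bisector_preserving_def by blast
  from image[of 1] obtain c where c: "c \<in> bary_coords" "f (bary_point p inc) = bary_point q c"
    by (auto simp: angle_bisector_def triangle_eq_bary)
  have "sum (reweight w inc) UNIV = 1"
    using fw[OF inc] by (simp add: reweight_def sum_divide_distrib[symmetric])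
  then have cw: "c = reweight w inc"
    using c fw[OF inc] by (intro bary_point_inject[OF q]) (auto simp: bary_coords_def)
  have proportional: "w j * bisector_weight p q k = w k * bisector_weight p q j" for j k
  proof -
    \<comment> \<open>the bisector from a third corner compares the coordinates \<open>j\<close> and \<open>k\<close>\<close>
    obtain i where i: "j \<noteq> i" "k \<noteq> i"
    proof (cases "j = k")
      case True
      then show thesis using that other_corner[of j] by metis
    next
      case False
      then show thesis using third_corner that by metis
    qed
    have "c j * opp_side q k = c k * opp_side q j"
      using image[of i] c i bary_point_in_angle_bisector_iff[OF q c(1)] by simp
    then have "inc j * w j * opp_side q k = inc k * w k * opp_side q j"
      using fw[OF inc] by (simp add: cw reweight_def field_simps)
    then have "opp_side p j * w j * opp_side q k = opp_side p k * w k * opp_side q j"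
      using sp by (simp add: inc_def field_simps)
    then show ?thesis using pos[of j] pos[of k] by (simp add: bisector_weight_def field_simps)
  qed
  have m: "0 < bisector_weight p q k" for k using bisector_weight_pos[OF p q] .
  have "w k = w 1 / bisector_weight p q 1 * bisector_weight p q k" for k
    using proportional[of k 1] m[of 1] by (simp add: field_simps)
  moreover have "w 1 / bisector_weight p q 1 \<noteq> 0" using w[of 1] m[of 1] by simp
  ultimately have "reweight w b = reweight (bisector_weight p q) b" by (rule reweight_scale[rotated])
  then show ?thesis using fw[OF b] by simp
qed

lemma bisector_map_bary_point:
  assumes p: "nondegenerate p" and q: "nondegenerate q" and b: "b \<in> bary_coords"
  shows "bisector_map p q (bary_point p b) = bary_point q (reweight (bisector_weight p q) b)"
proof -
  define f where "f = restrict
    (\<lambda>x. bary_point q (reweight (bisector_weight p q) (inv_into bary_coords (bary_point p) x)))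
    (triangle p)"
  have f: "f (bary_point p b) = bary_point q (reweight (bisector_weight p q) b)"
    if "b \<in> bary_coords" for b
    using that by (simp add: f_def triangle_eq_bary inv_into_f_f[OF inj_on_bary_point[OF p]])
  have ext: "f \<in> extensional (triangle p)" by (simp add: f_def)
  have "bisector_map p q = f"
    unfolding bisector_map_def
  proof (rule the_equality)
    show "bisector_preserving p q f \<and> f \<in> extensional (triangle p)"
      using bisector_preserving_reweight[OF p q f] ext by simp
  next
    fix g assume g: "bisector_preserving p q g \<and> g \<in> extensional (triangle p)"
    show "g = f"
    proof (rule extensionalityI)
      show "g \<in> extensional (triangle p)" using g by simp
      show "f \<in> extensional (triangle p)" by (fact ext)
      fix x assume "x \<in> triangle p"
      then obtain b where "b \<in> bary_coords" "x = bary_point p b"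
        by (auto simp: triangle_eq_bary)
      then show "g x = f x" using bisector_preserving_imp_reweight[OF p q] g f by simp
    qed
  qed
  then show ?thesis using f[OF b] by simp
qed

lemma bisector_map_edge:
  assumes p: "nondegenerate p" and q: "nondegenerate q" and ij: "i \<noteq> j" and r: "r \<in> {0..1}"
    and rho: "rho = r * bisector_weight p q j /
      ((1 - r) * bisector_weight p q i + r * bisector_weight p q j)"
  shows "bisector_map p q ((1 - r) *\<^sub>R p i + r *\<^sub>R p j) = (1 - rho) *\<^sub>R q i + rho *\<^sub>R q j"
    and "rho \<in> {0..1}"
proof -
  let ?m = "bisector_weight p q"
  let ?b = "\<lambda>k. if k = i then 1 - r else if k = j then r else 0"
  obtain k where k: "k \<noteq> i" "k \<noteq> j" using third_corner[OF ij] by metis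
  then have d: "i \<noteq> j" "i \<noteq> k" "j \<noteq> k" using ij by auto
  have b: "?b \<in> bary_coords"
    using r d by (auto simp: bary_coords_def sum_distinct_corners[OF d])
  have W: "(\<Sum>l\<in>UNIV. ?b l * ?m l) = (1 - r) * ?m i + r * ?m j"
    using d by (simp add: sum_distinct_corners[OF d])
  have Wpos: "0 < (1 - r) * ?m i + r * ?m j"
    using weighted_sum_pos[where w = ?m, OF b bisector_weight_pos[OF p q]] W by simp
  have pt: "bary_point p ?b = (1 - r) *\<^sub>R p i + r *\<^sub>R p j"
    using d by (simp add: bary_point_def sum_distinct_corners[OF d])
  have "1 - rho = (1 - r) * ?m i / ((1 - r) * ?m i + r * ?m j)"
    using Wpos by (simp add: rho field_simps)
  then have "bary_point q (reweight ?m ?b) = (1 - rho) *\<^sub>R q i + rho *\<^sub>R q j"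
    unfolding bary_point_def reweight_def W using d
    by (simp add: sum_distinct_corners[OF d] rho)
  then show "bisector_map p q ((1 - r) *\<^sub>R p i + r *\<^sub>R p j) = (1 - rho) *\<^sub>R q i + rho *\<^sub>R q j"
    using bisector_map_bary_point[OF p q b] pt by simp
  have "0 < ?m i" "0 < ?m j" using bisector_weight_pos[OF p q] by blast+
  then show "rho \<in> {0..1}"
    using Wpos r by (simp add: rho divide_le_eq_1_pos)
qed

text \<open>The parameter change \<open>r \<mapsto> rho\<close> of an edge is a fractional linear map of the unit interval that
  fixes the ends, so it is determined by the image of the midpoint, which encodes the quotient of
  the two weights.\<close>

lemma bisector_maps_agree_on_edge_iff:
  assumes p: "nondegenerate p" and q: "nondegenerate q" and ij: "i \<noteq> j"
    and p': "nondegenerate p'" and q': "nondegenerate q'" and kl: "k \<noteq> l"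
  shows "(\<forall>r\<in>{0..1}. \<exists>s\<in>{0..1}.
      bisector_map p q ((1 - r) *\<^sub>R p i + r *\<^sub>R p j) = (1 - s) *\<^sub>R q i + s *\<^sub>R q j \<and>
      bisector_map p' q' ((1 - r) *\<^sub>R p' k + r *\<^sub>R p' l) = (1 - s) *\<^sub>R q' k + s *\<^sub>R q' l) \<longleftrightarrow>
    bisector_weight p q i * bisector_weight p' q' l = bisector_weight p q j * bisector_weight p' q' k"
    (is "?L \<longleftrightarrow> ?R")
proof -
  let ?m = "bisector_weight p q" and ?n = "bisector_weight p' q'"
  let ?rho = "\<lambda>r. r * ?m j / ((1 - r) * ?m i + r * ?m j)"
  let ?tau = "\<lambda>r. r * ?n l / ((1 - r) * ?n k + r * ?n l)"
  have pos: "0 < ?m i" "0 < ?m j" "0 < ?n k" "0 < ?n l"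
    using bisector_weight_pos p q p' q' by blast+
  have edge_inj: "s = s'" if "(1 - s) *\<^sub>R x + s *\<^sub>R y = (1 - s') *\<^sub>R x + s' *\<^sub>R y" "x \<noteq> y"
    for s s' and x y :: "real^2"
  proof -
    have "(s - s') *\<^sub>R (y - x) = 0" using that(1) by (simp add: algebra_simps)
    then show ?thesis using that(2) by simp
  qed
  have ne: "q i \<noteq> q j" "q' k \<noteq> q' l"
    using q q' ij kl by (auto simp: nondegenerate_def inj_def)
  show ?thesis
  proof
    assume ?L
    moreover have half: "(1/2::real) \<in> {0..1}" by simp
    ultimately obtain s where
      "bisector_map p q ((1 - 1/2) *\<^sub>R p i + (1/2) *\<^sub>R p j) = (1 - s) *\<^sub>R q i + s *\<^sub>R q j"
      "bisector_map p' q' ((1 - 1/2) *\<^sub>R p' k + (1/2) *\<^sub>R p' l) = (1 - s) *\<^sub>R q' k + s *\<^sub>R q' l"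
      by blast
    then have "s = ?rho (1/2)" "s = ?tau (1/2)"
      using bisector_map_edge(1)[OF p q ij half refl] bisector_map_edge(1)[OF p' q' kl half refl]
        edge_inj[OF _ ne(1)] edge_inj[OF _ ne(2)] by metis+
    then have "?rho (1/2) = ?tau (1/2)" by simp
    then have "?m j / (?m i + ?m j) = ?n l / (?n k + ?n l)"
      using pos by (simp add: field_simps)
    moreover have "?m i + ?m j \<noteq> 0" "?n k + ?n l \<noteq> 0" using pos by linarith+
    ultimately show ?R by (simp add: frac_eq_eq algebra_simps)
  next
    assume R: ?R
    have "?rho r = ?tau r" if r: "r \<in> {0..1}" for r
    proof -
      have "0 < (1 - r) * x + r * y" if "0 < x" "0 < y" for x y
        using r that by (cases "r = 0") (auto intro: add_nonneg_pos)
      then have "(1 - r) * ?m i + r * ?m j \<noteq> 0" "(1 - r) * ?n k + r * ?n l \<noteq> 0"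
        using pos by (metis less_irrefl)+
      moreover have "r * ?m j * ((1 - r) * ?n k + r * ?n l) =
          r * ?n l * ((1 - r) * ?m i + r * ?m j)"
        using R by algebra
      ultimately show ?thesis by (simp add: frac_eq_eq)
    qed
    then show ?L
      using bisector_map_edge[OF p q ij _ refl] bisector_map_edge[OF p' q' kl _ refl] by metis
  qed
qed

section \<open>Scale factors at the corners\<close>

text \<open>The unique solution \<open>u\<close> of the three equations saying that each side is stretched by the factor
  \<open>exp ((u i + u j) / 2)\<close>; see \<open>edge_scaling_iff\<close> and \<open>corner_factor_unique\<close>.\<close>

definition corner_factor :: "(3 \<Rightarrow> real^2) \<Rightarrow> (3 \<Rightarrow> real^2) \<Rightarrow> 3 \<Rightarrow> real" where
  "corner_factor p q i =
     (\<Sum>k\<in>UNIV. ln (bisector_weight p q k)) - 2 * ln (bisector_weight p q i)"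

lemma corner_factor_sum:
  assumes p: "nondegenerate p" and q: "nondegenerate q" and ij: "i \<noteq> j"
  shows "corner_factor p q i + corner_factor p q j = 2 * ln (dist (q i) (q j) / dist (p i) (p j))"
proof -
  obtain k where k: "k \<noteq> i" "k \<noteq> j" using third_corner[OF ij] by metis
  then have d: "i \<noteq> j" "i \<noteq> k" "j \<noteq> k" using ij by auto
  have "bisector_weight p q k = dist (q i) (q j) / dist (p i) (p j)"
    using d by (simp add: bisector_weight_def opp_side_eq)
  moreover have "corner_factor p q i + corner_factor p q j = 2 * ln (bisector_weight p q k)"
    by (simp add: corner_factor_def sum_distinct_corners[OF d])
  ultimately show ?thesis by simp
qed

lemma edge_scaling_iff:
  assumes p: "nondegenerate p" and q: "nondegenerate q" and ij: "i \<noteq> j"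
  shows "dist (q i) (q j) = exp (x / 2) * dist (p i) (p j) \<longleftrightarrow>
    x = corner_factor p q i + corner_factor p q j"
proof -
  have pos: "0 < dist (p i) (p j)" "0 < dist (q i) (q j)"
    using p q ij by (auto simp: nondegenerate_def inj_def)
  have "dist (q i) (q j) = exp (x / 2) * dist (p i) (p j) \<longleftrightarrow>
      exp (x / 2) = dist (q i) (q j) / dist (p i) (p j)"
    using pos by (auto simp: field_simps)
  also have "\<dots> \<longleftrightarrow> x / 2 = ln (dist (q i) (q j) / dist (p i) (p j))"
    using pos by (metis divide_pos_pos exp_ln ln_exp)
  finally show ?thesis using corner_factor_sum[OF p q ij] by auto
qed

text \<open>The equations for the three sides determine the values at the corners, since
  \<open>2 * u i = (u i + u j) + (u i + u k) - (u j + u k)\<close>.\<close>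

lemma corner_factor_unique:
  fixes u :: "3 \<Rightarrow> real"
  assumes "\<And>i j. i \<noteq> j \<Longrightarrow> u i + u j = v i + v j"
  shows "u i = v i"
proof -
  obtain j where "j \<noteq> i" using other_corner .
  moreover then obtain k where "k \<noteq> i" "k \<noteq> j" using third_corner by metis
  ultimately show ?thesis
    using assms[of i j] assms[of i k] assms[of j k] by simp
qed

text \<open>The quotient of the weights gives the difference of the corner factors at the ends of the edge,
  and the stretching of the edge gives their sum. As the sums agree, the differences agree exactly
  when the factors do.\<close>

lemma bisector_weight_ratio_iff:
  assumes p: "nondegenerate p" and q: "nondegenerate q" and ij: "i \<noteq> j"
    and p': "nondegenerate p'" and q': "nondegenerate q'" and kl: "k \<noteq> l"
    and lp: "dist (p i) (p j) = dist (p' k) (p' l)" and lq: "dist (q i) (q j) = dist (q' k) (q' l)"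
  shows "bisector_weight p q i * bisector_weight p' q' l =
      bisector_weight p q j * bisector_weight p' q' k \<longleftrightarrow>
    corner_factor p q i = corner_factor p' q' k \<and> corner_factor p q j = corner_factor p' q' l"
proof -
  let ?m = "bisector_weight p q" and ?n = "bisector_weight p' q'"
  have pos: "0 < ?m i" "0 < ?m j" "0 < ?n k" "0 < ?n l"
    using bisector_weight_pos p q p' q' by blast+
  have "?m i * ?n l = ?m j * ?n k \<longleftrightarrow> ln (?m i * ?n l) = ln (?m j * ?n k)"
    using pos by simp
  also have "\<dots> \<longleftrightarrow> ln (?m i) + ln (?n l) = ln (?m j) + ln (?n k)"
    using pos by (simp add: ln_mult)
  also have "\<dots> \<longleftrightarrow> corner_factor p q i - corner_factor p q j =
      corner_factor p' q' k - corner_factor p' q' l"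
    by (auto simp: corner_factor_def)
  finally show ?thesis
    using corner_factor_sum[OF p q ij] corner_factor_sum[OF p' q' kl] lp lq by auto
qed

section \<open>Vertices of the surface\<close>

lemma vertex_of_glued:
  assumes S: "triangulated_surface S" and g: "((t, i, j), (s, k, l)) \<in> glue S"
  shows "vertex_of S (t, i) = vertex_of S (s, k)"
proof -
  have "((s, k, l), (t, i, j)) \<in> glue S"
    using S g unfolding triangulated_surface_def sym_def by blast
  then have "((t, i), (s, k)) \<in> corner_rel S" "((s, k), (t, i)) \<in> corner_rel S"
    using g unfolding corner_rel_def by blast+
  then show ?thesis
    unfolding vertex_of_def corner_rel_def by (auto intro: rtrancl_trans)
qed

text \<open>Gluing steps generate the vertex classes, so invariance under single steps makes the image of each
  class a singleton, whose element is the value at the vertex.\<close>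

lemma vertex_function_exists:
  assumes "\<And>t i j s k l. ((t, i, j), (s, k, l)) \<in> glue S \<Longrightarrow> U (t, i) = U (s, k)"
  obtains u where "\<And>c. u (vertex_of S c) = U c"
proof -
  have "U d = U c" if "(c, d) \<in> corner_rel S" for c d
    using that unfolding corner_rel_def
    by (induction rule: rtrancl_induct) (use assms in \<open>auto\<close>)
  then have "U ` vertex_of S c = {U c}" for c
    unfolding vertex_of_def corner_rel_def by auto
  then have "the_elem (U ` vertex_of S c) = U c" for c by simp
  then show thesis using that[of "\<lambda>V. the_elem (U ` V)"] by blast
qed

theorem theorem5p3:
  fixes S :: "'f tri_complex" and S' :: "'g tri_complex"
    and \<phi> :: "'f \<Rightarrow> 'g" and \<sigma> :: "'f \<Rightarrow> 3 \<Rightarrow> 3"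
  assumes "triangulated_surface S" and "triangulated_surface S'"
    and "combinatorial_equivalence S S' \<phi> \<sigma>"
  shows "fit_together S S' \<phi> \<sigma> (\<lambda>t. bisector_map (pos S t) (pos S' (\<phi> t) \<circ> \<sigma> t)) \<longleftrightarrow>
    discretely_conformally_equivalent S S' \<phi> \<sigma>"
proof -
  define p where "p = pos S"
  define q where "q t = pos S' (\<phi> t) \<circ> \<sigma> t" for t
  \<comment> \<open>the only candidate for the scale factors, defined corner by corner\<close>
  define U where "U = (\<lambda>(t, i). corner_factor (p t) (q t) i)"
  have p: "nondegenerate (p t)" if "t \<in> faces S" for t
    using assms(1) that by (simp add: p_def triangulated_surface_def)
  have q: "nondegenerate (q t)" if "t \<in> faces S" for t
  proof -
    have "\<phi> t \<in> faces S'" and b: "bij (\<sigma> t)"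
      using assms(3) that by (auto simp: combinatorial_equivalence_def bij_betw_def)
    then have "nondegenerate (pos S' (\<phi> t))"
      using assms(2) by (simp add: triangulated_surface_def)
    moreover have "range (q t) = range (pos S' (\<phi> t))"
      using b unfolding q_def by (metis bij_is_surj image_comp)
    ultimately show ?thesis
      using b by (auto simp: nondegenerate_def q_def bij_is_inj intro!: inj_compose)
  qed
  have glued: "t \<in> faces S" "i \<noteq> j" "s \<in> faces S" "k \<noteq> l"
      "dist (p t i) (p t j) = dist (p s k) (p s l)" "dist (q t i) (q t j) = dist (q s k) (q s l)"
      "((t, j, i), (s, l, k)) \<in> glue S"
    if g: "((t, i, j), (s, k, l)) \<in> glue S" for t i j s k l
  proof -
    have sd: "(t, i, j) \<in> sides S" "(s, k, l) \<in> sides S"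
      using g assms(1) unfolding triangulated_surface_def by blast+
    then show "t \<in> faces S" "i \<noteq> j" "s \<in> faces S" "k \<noteq> l" by (auto simp: sides_def)
    show "((t, j, i), (s, l, k)) \<in> glue S"
      using g assms(1) unfolding triangulated_surface_def by blast
    have "side_length S (t, i, j) = side_length S (s, k, l)"
      using g assms(1) unfolding triangulated_surface_def by blast
    then show "dist (p t i) (p t j) = dist (p s k) (p s l)"
      by (simp add: side_length_def p_def)
    have "(map_side \<phi> \<sigma> (t, i, j), map_side \<phi> \<sigma> (s, k, l)) \<in> glue S'"
      using g sd assms(3) unfolding combinatorial_equivalence_def by blast
    then have "side_length S' (map_side \<phi> \<sigma> (t, i, j)) = side_length S' (map_side \<phi> \<sigma> (s, k, l))"
      using assms(2) unfolding triangulated_surface_def by blast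
    then show "dist (q t i) (q t j) = dist (q s k) (q s l)"
      by (simp add: side_length_def map_side_def q_def)
  qed
  have "fit_together S S' \<phi> \<sigma> (\<lambda>t. bisector_map (p t) (q t)) \<longleftrightarrow>
    (\<forall>t i j s k l. ((t, i, j), (s, k, l)) \<in> glue S \<longrightarrow> (\<forall>r\<in>{0..1}. \<exists>r'\<in>{0..1}.
      bisector_map (p t) (q t) ((1 - r) *\<^sub>R p t i + r *\<^sub>R p t j) =
        (1 - r') *\<^sub>R q t i + r' *\<^sub>R q t j \<and>
      bisector_map (p s) (q s) ((1 - r) *\<^sub>R p s k + r *\<^sub>R p s l) =
        (1 - r') *\<^sub>R q s k + r' *\<^sub>R q s l))"
    by (fastforce simp: fit_together_def same_edge_point_def map_side_def p_def q_def)
  also have "\<dots> \<longleftrightarrow> (\<forall>t i j s k l. ((t, i, j), (s, k, l)) \<in> glue S \<longrightarrow>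
      U (t, i) = U (s, k) \<and> U (t, j) = U (s, l))"
    using bisector_maps_agree_on_edge_iff[OF p q _ p q] bisector_weight_ratio_iff[OF p q _ p q] glued
    by (simp add: U_def)
  finally have fit: "fit_together S S' \<phi> \<sigma> (\<lambda>t. bisector_map (p t) (q t)) \<longleftrightarrow> \<dots>" .
  have conf: "discretely_conformally_equivalent S S' \<phi> \<sigma> \<longleftrightarrow>
    (\<exists>u. \<forall>t\<in>faces S. \<forall>i j. i \<noteq> j \<longrightarrow>
      u (vertex_of S (t, i)) + u (vertex_of S (t, j)) = U (t, i) + U (t, j))"
  proof -
    have "side_length S' (map_side \<phi> \<sigma> (t, i, j)) = exp (x / 2) * side_length S (t, i, j) \<longleftrightarrow>
        x = U (t, i) + U (t, j)" if "t \<in> faces S" "i \<noteq> j" for t i j x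
      using edge_scaling_iff[OF p[OF that(1)] q[OF that(1)] that(2)]
      by (simp add: side_length_def map_side_def U_def p_def q_def)
    then show ?thesis
      using assms(3) by (auto simp: discretely_conformally_equivalent_def sides_def)
  qed
  have "fit_together S S' \<phi> \<sigma> (\<lambda>t. bisector_map (p t) (q t)) \<longleftrightarrow>
    discretely_conformally_equivalent S S' \<phi> \<sigma>"
  proof
    assume "fit_together S S' \<phi> \<sigma> (\<lambda>t. bisector_map (p t) (q t))"
    then have "U (t, i) = U (s, k)" if "((t, i, j), (s, k, l)) \<in> glue S" for t i j s k l
      using that unfolding fit by blast
    then obtain u where "\<And>c. u (vertex_of S c) = U c"
      using vertex_function_exists by metis
    then show "discretely_conformally_equivalent S S' \<phi> \<sigma>" unfolding conf by (intro exI[of _ u]) simp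
  next
    assume "discretely_conformally_equivalent S S' \<phi> \<sigma>"
    then obtain u where u: "\<forall>t\<in>faces S. \<forall>i j. i \<noteq> j \<longrightarrow>
        u (vertex_of S (t, i)) + u (vertex_of S (t, j)) = U (t, i) + U (t, j)"
      unfolding conf by (elim exE)
    have U: "U (t, i) = u (vertex_of S (t, i))" if "t \<in> faces S" for t i
      by (rule corner_factor_unique[of "\<lambda>i. U (t, i)" "\<lambda>i. u (vertex_of S (t, i))"])
        (use u that in simp)
    have "U (t, i) = U (s, k)" if "((t, i, j), (s, k, l)) \<in> glue S" for t i j s k l
      using U glued[OF that] vertex_of_glued[OF assms(1) that] by simp
    then show "fit_together S S' \<phi> \<sigma> (\<lambda>t. bisector_map (p t) (q t))"
      unfolding fit using glued(7) by blast
  qed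
  then show ?thesis by (simp add: p_def q_def[abs_def])
qed

end
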